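(* Let $m\ge 1$ and let $P_m$ be a stationary probability measure on $S_m$. Then $P_m$ can be extended to a stationary probability measure $P_{m+1}$ on $S_{m+1}$, i.e. there is a stationary probability measure $P_{m+1}$ on $S_{m+1}$ with $$P_{m+1}\{\pi\in S_{m+1}\ :\ \pi_1\dots\pi_m\text{ shows pattern }\lambda\}=P_m(\lambda)\quad\text{for all }\lambda\in S_m .$$ Hence $P_m$ can also be extended to a stationary random order on $\mathbb{N}$, i.e. there is a stationary probability measure $P$ on the set of all orders on $\mathbb{N}$ with $P\{x_1,\dots,x_m\text{ show pattern }\lambda\}=P_m(\lambda)$ for all $\lambda\in S_m$.
   Context: $\mathbb{N}=\{1,2,\dots\}$; $S_m$ is the set of permutations $\pi=\pi_1\dots\pi_m$ of $\{1,\dots,m\}$. A finite sequence of distinct numbers $y_1,\dots,y_k$ shows pattern $\kappa\in S_k$ if $y_i<y_j\iff\kappa_i<\kappa_j$ for all $i,j$. A probability measure $Q$ on $S_T$ is stationary if for every $k<T$ and every $\kappa\in S_k$ the probability $Q\{\pi\in S_T:\ \pi_t\pi_{t+1}\dots\pi_{t+k-1}\text{ shows pattern }\kappa\}$ is the same for all $t$ with $1\le t\le T+1-k$. An order on $\mathbb{N}$ is a strict total order $\prec$ on $\mathbb{N}$, thought of as an ordering of objects $x_1,x_2,\dots$; objects $x_t,\dots,x_{t+k-1}$ show pattern $\kappa\in S_k$ if $x_{t+i-1}\prec x_{t+j-1}\iff\kappa_i<\kappa_j$ for all $i,j$. A random order on $\mathbb{N}$ is a probability measure $P$ on the set of all orders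 on $\mathbb{N}$ (with the $\sigma$-algebra generated by the events that $x_1,\dots,x_k$ show pattern $\kappa$, $k\ge2$, $\kappa\in S_k$). It is stationary if for every $k$ and every $\kappa\in S_k$ the probability $P\{x_t,\dots,x_{t+k-1}\text{ show pattern }\kappa\}$ does not depend on $t\ge1$. *)

theory Defs
  imports "HOL-Probability.Probability" "HOL-Combinatorics.Permutations"
begin

text \<open>
  A permutation \<open>\<pi> = \<pi>\<^sub>1\<dots>\<pi>\<^sub>m\<close> is the function \<open>i \<mapsto> \<pi>\<^sub>i\<close>, extended by the identity
  outside \<open>{1..m}\<close>. The index set is \<open>{1, 2, \<dots>}\<close> throughout.
\<close>

definition perms :: "nat \<Rightarrow> (nat \<Rightarrow> nat) set" where
  "perms m = {\<pi>. \<pi> permutes {1..m}}"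

text \<open>Only the entries \<open>y 1, \<dots>, y k\<close> of \<open>y\<close> and \<open>\<kappa> 1, \<dots>, \<kappa> k\<close> of \<open>\<kappa>\<close> matter.\<close>

definition shows_pattern :: "nat \<Rightarrow> (nat \<Rightarrow> nat) \<Rightarrow> (nat \<Rightarrow> nat) \<Rightarrow> bool" where
  "shows_pattern k y \<kappa> \<longleftrightarrow> (\<forall>i\<in>{1..k}. \<forall>j\<in>{1..k}. y i < y j \<longleftrightarrow> \<kappa> i < \<kappa> j)"

text \<open>
  A probability measure on the finite set \<open>perms T\<close> is a probability mass function with
  support in \<open>perms T\<close>. The truncated subtraction in \<open>t + i - 1\<close> is harmless, as \<open>t \<ge> 1\<close>.
\<close>

definition stationary_perm_pmf :: "nat \<Rightarrow> (nat \<Rightarrow> nat) pmf \<Rightarrow> bool" where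
  "stationary_perm_pmf T Q \<longleftrightarrow>
     set_pmf Q \<subseteq> perms T \<and>
     (\<forall>k \<kappa>. 1 \<le> k \<and> k < T \<and> \<kappa> \<in> perms k \<longrightarrow>
        (\<forall>s\<in>{1..T + 1 - k}. \<forall>t\<in>{1..T + 1 - k}.
           measure_pmf.prob Q {\<pi> \<in> perms T. shows_pattern k (\<lambda>i. \<pi> (s + i - 1)) \<kappa>} =
           measure_pmf.prob Q {\<pi> \<in> perms T. shows_pattern k (\<lambda>i. \<pi> (t + i - 1)) \<kappa>}))"

text \<open>
  The inclusion in \<open>{1..} \<times> {1..}\<close> is needed because \<^const>\<open>strict_linear_order_on\<close>
  does not bound the field of the relation. The pair \<open>(a, b) \<in> r\<close> means \<open>x\<^sub>a \<prec> x\<^sub>b\<close>.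
\<close>

definition nat_orders :: "(nat \<times> nat) set set" where
  "nat_orders = {r. r \<subseteq> {1..} \<times> {1..} \<and> strict_linear_order_on {1..} r}"

text \<open>The objects \<open>x\<^sub>t, \<dots>, x\<^bsub>t+k-1\<^esub>\<close> show pattern \<open>\<kappa>\<close> in the order \<open>r\<close>.\<close>

definition objects_show_pattern ::
    "(nat \<times> nat) set \<Rightarrow> nat \<Rightarrow> nat \<Rightarrow> (nat \<Rightarrow> nat) \<Rightarrow> bool" where
  "objects_show_pattern r t k \<kappa> \<longleftrightarrow>
     (\<forall>i\<in>{1..k}. \<forall>j\<in>{1..k}. (t + i - 1, t + j - 1) \<in> r \<longleftrightarrow> \<kappa> i < \<kappa> j)"

definition order_space :: "(nat \<times> nat) set measure" where
  "order_space = sigma nat_orders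
     {{r \<in> nat_orders. objects_show_pattern r 1 k \<kappa>} | k \<kappa>. 2 \<le> k \<and> \<kappa> \<in> perms k}"

definition random_order :: "(nat \<times> nat) set measure \<Rightarrow> bool" where
  "random_order P \<longleftrightarrow>
     prob_space P \<and> space P = space order_space \<and> sets P = sets order_space"

definition stationary_random_order :: "(nat \<times> nat) set measure \<Rightarrow> bool" where
  "stationary_random_order P \<longleftrightarrow>
     random_order P \<and>
     (\<forall>k \<kappa>. 1 \<le> k \<and> \<kappa> \<in> perms k \<longrightarrow>
        (\<forall>s\<ge>1. \<forall>t\<ge>1.
           measure P {r \<in> nat_orders. objects_show_pattern r s k \<kappa>} =
           measure P {r \<in> nat_orders. objects_show_pattern r t k \<kappa>}))"

end

theory Submission imports Defs begin

text \<open>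
  One extra letter can be added because stationarity is a statement about overlaps. In a permutation
  of length \<open>m\<close> drawn from a stationary law, the initial and the final windows of length \<open>m - 1\<close> show
  equally distributed patterns. Two copies of the law can therefore be coupled such that the final
  window of the first copy agrees with the initial window of the second, and two permutations that
  agree on this overlap have a common extension of length \<open>m + 1\<close>: linear orders amalgamate over a
  common part (\<open>glue_patterns\<close>). The law of the extension has both windows of length \<open>m\<close>
  distributed as prescribed, and any shorter window is contained in one of these, which gives
  stationarity (\<open>stationary_extension\<close>).

  Iteration yields stationary laws of all lengths from \<open>m\<close> on, each projecting to the previous one.
  They are realized together as a random sequence of permutations in which every member extends the
  one before (\<open>pmf_inverse_limit\<close>). Such a sequence defines an order on the positive integers, in
  which any finite window can be seen at all sufficiently late members of the sequence
  (\<open>limit_order\<close>). The law of this random order inherits stationarity, because two windows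
  of the same length can be compared within a single finite permutation.
\<close>

section \<open>Patterns of windows\<close>

abbreviation window :: "nat \<Rightarrow> (nat \<Rightarrow> nat) \<Rightarrow> nat \<Rightarrow> nat" where
  "window s y \<equiv> (\<lambda>i. y (s + i - 1))"

text \<open>
  Standardization: each entry is replaced by its rank among the first \<open>k\<close> entries. Ranks count
  weakly smaller entries, so they start at 1. Outside \<open>{1..k}\<close> the value is that of the identity,
  the convention for members of \<^term>\<open>perms k\<close>.
\<close>

definition std :: "nat \<Rightarrow> (nat \<Rightarrow> nat) \<Rightarrow> nat \<Rightarrow> nat" where
  "std k y = (\<lambda>i. if i \<in> {1..k} then card {j \<in> {1..k}. y j \<le> y i} else i)"

lemma finite_perms: "finite (perms k)"
  unfolding perms_def by (rule finite_permutations) simp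

lemma shows_pattern_std: "shows_pattern k y (std k y)"
  unfolding shows_pattern_def
proof (intro ballI)
  fix i j assume ij: "i \<in> {1..k}" "j \<in> {1..k}"
  let ?A = "\<lambda>i. {l \<in> {1..k}. y l \<le> y i}"
  have "card (?A i) < card (?A j)" if "y i < y j"
  proof (rule psubset_card_mono)
    have "j \<in> ?A j - ?A i"
      using that ij by simp
    moreover have "?A i \<subseteq> ?A j"
      using that by auto
    ultimately show "?A i \<subset> ?A j"
      by blast
  qed simp
  moreover have "card (?A j) \<le> card (?A i)" if "\<not> y i < y j"
    by (rule card_mono) (use that in auto)
  ultimately show "y i < y j \<longleftrightarrow> std k y i < std k y j"
    using ij by (fastforce simp: std_def)
qed

lemma std_in_perms:
  assumes "inj_on y {1..k}"
  shows "std k y \<in> perms k"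
proof -
  have inj: "inj_on (std k y) {1..k}"
  proof (rule inj_onI)
    fix i j assume ij: "i \<in> {1..k}" "j \<in> {1..k}" and "std k y i = std k y j"
    then have "\<not> y i < y j" "\<not> y j < y i"
      using shows_pattern_std[of k y] by (auto simp: shows_pattern_def)
    then show "i = j"
      using assms ij by (auto dest: inj_onD)
  qed
  have "std k y i \<in> {1..k}" if "i \<in> {1..k}" for i
  proof -
    have "card {j \<in> {1..k}. y j \<le> y i} \<le> card {1..k}"
      by (rule card_mono) auto
    moreover have "card {j \<in> {1..k}. y j \<le> y i} > 0"
      using that by (auto simp: card_gt_0_iff)
    ultimately show ?thesis
      using that by (simp add: std_def)
  qed
  then have "std k y ` {1..k} \<subseteq> {1..k}"
    by blast
  then have "std k y ` {1..k} = {1..k}"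
    using inj by (simp add: endo_inj_surj)
  then have "bij_betw (std k y) {1..k} {1..k}"
    using inj by (simp add: bij_betw_def)
  then show ?thesis
    unfolding perms_def by (auto intro!: bij_imp_permutes simp: std_def)
qed

lemma std_cong:
  assumes "shows_pattern k y z"
  shows "std k y = std k z"
proof -
  have "{j \<in> {1..k}. y j \<le> y i} = {j \<in> {1..k}. z j \<le> z i}" if "i \<in> {1..k}" for i
    using assms that unfolding shows_pattern_def by (metis not_less)
  then show ?thesis
    unfolding std_def by (auto simp: fun_eq_iff)
qed

lemma std_perm:
  assumes "\<kappa> \<in> perms k"
  shows "std k \<kappa> = \<kappa>"
proof
  fix i
  have p: "\<kappa> permutes {1..k}"
    using assms by (simp add: perms_def)
  show "std k \<kappa> i = \<kappa> i"
  proof (cases "i \<in> {1..k}")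
    case True
    then have \<kappa>i: "\<kappa> i \<in> {1..k}"
      using permutes_in_image[OF p] by blast
    have "\<kappa> ` {j \<in> {1..k}. \<kappa> j \<le> \<kappa> i} = {l \<in> \<kappa> ` {1..k}. l \<le> \<kappa> i}"
      by blast
    also have "\<dots> = {1..\<kappa> i}"
      unfolding permutes_image[OF p] using \<kappa>i by auto
    finally have "card (\<kappa> ` {j \<in> {1..k}. \<kappa> j \<le> \<kappa> i}) = \<kappa> i"
      by simp
    then have "card {j \<in> {1..k}. \<kappa> j \<le> \<kappa> i} = \<kappa> i"
      by (subst (asm) card_image) (auto intro: inj_on_subset[OF permutes_inj[OF p]])
    with True show ?thesis
      by (simp add: std_def)
  next
    case False
    then have "\<kappa> i = i"
      by (rule permutes_not_in[OF p])
    with False show ?thesis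
      by (simp only: std_def if_False)
  qed
qed

text \<open>
  Since a pattern is determined by the order of its entries, the predicate becomes an equation.
  Statements about probabilities of patterns thereby turn into statements about image measures
  under \<^term>\<open>\<lambda>y. std k (window s y)\<close>, which compose well.
\<close>

lemma shows_pattern_iff_std:
  assumes "\<kappa> \<in> perms k"
  shows "shows_pattern k y \<kappa> \<longleftrightarrow> std k y = \<kappa>"
proof
  assume "shows_pattern k y \<kappa>"
  then have "std k y = std k \<kappa>"
    by (rule std_cong)
  then show "std k y = \<kappa>"
    by (simp add: std_perm[OF assms])
next
  assume "std k y = \<kappa>"
  then show "shows_pattern k y \<kappa>"
    using shows_pattern_std[of k y] by simp
qed

lemma inj_on_window:
  assumes "\<pi> \<in> perms n" "1 \<le> s"
  shows "inj_on (window s \<pi>) {1..k}"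
proof (rule inj_onI)
  fix i j assume "i \<in> {1..k}" "j \<in> {1..k}" and "\<pi> (s + i - 1) = \<pi> (s + j - 1)"
  moreover have "inj \<pi>"
    using assms by (auto simp: perms_def permutes_inj)
  ultimately have "s + i - 1 = s + j - 1"
    by (blast dest: injD)
  with \<open>1 \<le> s\<close> show "i = j"
    by linarith
qed

lemma shows_pattern_window:
  assumes "shows_pattern n y z" "1 \<le> s" "s + k \<le> n + 1"
  shows "shows_pattern k (window s y) (window s z)"
  unfolding shows_pattern_def
proof (intro ballI)
  fix i j assume "i \<in> {1..k}" "j \<in> {1..k}"
  with assms have "s + i - 1 \<in> {1..n}" "s + j - 1 \<in> {1..n}"
    by auto
  with assms show "y (s + i - 1) < y (s + j - 1) \<longleftrightarrow> z (s + i - 1) < z (s + j - 1)"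
    unfolding shows_pattern_def by blast
qed

text \<open>
  Standardizing a longer stretch first loses nothing; this makes restrictions to shorter and shorter
  windows compose.
\<close>

lemma std_window_std:
  assumes "1 \<le> s" "s + k \<le> n + 1"
  shows "std k (window s (std n y)) = std k (window s y)"
  using std_cong[OF shows_pattern_window[OF shows_pattern_std[of n y] assms]] by (rule sym)

lemma prob_shows_pattern:
  assumes "set_pmf Q \<subseteq> perms T" "\<kappa> \<in> perms k"
  shows "measure_pmf.prob Q {\<pi> \<in> perms T. shows_pattern k (window s \<pi>) \<kappa>} =
         pmf (map_pmf (\<lambda>\<pi>. std k (window s \<pi>)) Q) \<kappa>"
  unfolding pmf_map
proof (rule measure_pmf.finite_measure_eq_AE)
  have "\<pi> \<in> {\<pi> \<in> perms T. shows_pattern k (window s \<pi>) \<kappa>} \<longleftrightarrow>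
      \<pi> \<in> (\<lambda>\<pi>. std k (window s \<pi>)) -` {\<kappa>}" if "\<pi> \<in> set_pmf Q" for \<pi>
    using subsetD[OF assms(1) that] shows_pattern_iff_std[OF assms(2)] by simp
  then show "AE \<pi> in Q. \<pi> \<in> {\<pi> \<in> perms T. shows_pattern k (window s \<pi>) \<kappa>} \<longleftrightarrow>
      \<pi> \<in> (\<lambda>\<pi>. std k (window s \<pi>)) -` {\<kappa>}"
    by (simp only: AE_measure_pmf_iff) blast
qed simp_all

text \<open>
  A law on patterns is determined by its point masses. The length \<open>k = 0\<close>, which the definition of
  stationarity leaves out, is harmless because there is only one empty pattern; including it spares
  case distinctions for permutations of length 1.
\<close>

lemma stationary_iff_map_pmf:
  "stationary_perm_pmf T Q \<longleftrightarrow>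
     set_pmf Q \<subseteq> perms T \<and>
     (\<forall>k<T. \<forall>s\<in>{1..T + 1 - k}. \<forall>t\<in>{1..T + 1 - k}.
        map_pmf (\<lambda>\<pi>. std k (window s \<pi>)) Q = map_pmf (\<lambda>\<pi>. std k (window t \<pi>)) Q)"
  (is "_ \<longleftrightarrow> ?S \<and> ?R")
proof -
  have "stationary_perm_pmf T Q \<longleftrightarrow> ?R" if S: ?S
  proof
    assume st: "stationary_perm_pmf T Q"
    show ?R
    proof (intro allI impI ballI pmf_eqI)
      fix k s t \<kappa>
      assume k: "k < T" and s: "s \<in> {1..T + 1 - k}" and t: "t \<in> {1..T + 1 - k}"
      let ?p = "\<lambda>s. pmf (map_pmf (\<lambda>\<pi>. std k (window s \<pi>)) Q) \<kappa>"
      consider "k = 0" | "\<kappa> \<notin> perms k" | "1 \<le> k" "\<kappa> \<in> perms k"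
        by linarith
      then show "?p s = ?p t"
      proof cases
        case 1
        then show ?thesis
          by (simp add: std_def)
      next
        case 2
        have "?p u = 0" if "1 \<le> u" for u
          using 2 S that inj_on_window
          by (auto simp: pmf_eq_0_set_pmf dest!: subsetD intro: std_in_perms)
        with s t show ?thesis
          by simp
      next
        case 3
        with st k s t have
          "measure_pmf.prob Q {\<pi> \<in> perms T. shows_pattern k (window s \<pi>) \<kappa>} =
           measure_pmf.prob Q {\<pi> \<in> perms T. shows_pattern k (window t \<pi>) \<kappa>}"
          unfolding stationary_perm_pmf_def by blast
        then show ?thesis
          unfolding prob_shows_pattern[OF S 3(2)] .
      qed
    qed
  next
    assume R: ?R
    show "stationary_perm_pmf T Q"
      unfolding stationary_perm_pmf_def
    proof (intro conjI allI impI ballI S)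
      fix k \<kappa> s t
      assume k: "1 \<le> k \<and> k < T \<and> \<kappa> \<in> perms k"
        and s: "s \<in> {1..T + 1 - k}" and t: "t \<in> {1..T + 1 - k}"
      then have eq: "map_pmf (\<lambda>\<pi>. std k (window s \<pi>)) Q = map_pmf (\<lambda>\<pi>. std k (window t \<pi>)) Q"
        using R by blast
      from k have \<kappa>: "\<kappa> \<in> perms k"
        by simp
      show "measure_pmf.prob Q {\<pi> \<in> perms T. shows_pattern k (window s \<pi>) \<kappa>} =
            measure_pmf.prob Q {\<pi> \<in> perms T. shows_pattern k (window t \<pi>) \<kappa>}"
        unfolding prob_shows_pattern[OF S \<kappa>] eq ..
    qed
  qed
  moreover have "stationary_perm_pmf T Q \<Longrightarrow> ?S"
    by (simp add: stationary_perm_pmf_def)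
  ultimately show ?thesis
    by blast
qed

section \<open>Extension by one letter\<close>

text \<open>
  \<open>\<pi>\<close> describes the order of the places \<open>1, \<dots>, m\<close> and \<open>\<sigma>\<close> that of the places \<open>2, \<dots>, m + 1\<close>. The new
  last letter is put directly above the largest of the letters at \<open>2, \<dots>, m\<close> that \<open>\<sigma>\<close> places below
  it. Doubling \<open>\<pi>\<close> leaves the odd values free for it, so that it does not collide with the first
  letter, whose position relative to it neither \<open>\<pi>\<close> nor \<open>\<sigma>\<close> prescribes. The extra 0 is the cut
  below everything.
\<close>

definition glue :: "nat \<Rightarrow> (nat \<Rightarrow> nat) \<Rightarrow> (nat \<Rightarrow> nat) \<Rightarrow> nat \<Rightarrow> nat" where
  "glue m \<pi> \<sigma> = std (m + 1)
     ((\<lambda>i. 2 * \<pi> i)(m + 1 := 1 + Max (insert 0 {2 * \<pi> (i + 1) |i. i \<in> {1..<m} \<and> \<sigma> i < \<sigma> m})))"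

text \<open>
  The letters that \<open>\<sigma>\<close> puts below its last one form a down-set in the order of the places
  \<open>2, \<dots>, m\<close>; because \<open>\<pi>\<close> orders these places in the same way, the down-set is one for \<open>\<pi>\<close> too, and a
  single new value separates it from the rest.
\<close>

lemma glue_patterns:
  assumes m: "1 \<le> m" and \<pi>: "\<pi> \<in> perms m" and \<sigma>: "\<sigma> \<in> perms m"
    and overlap: "std (m - 1) \<sigma> = std (m - 1) (window 2 \<pi>)"
  shows "glue m \<pi> \<sigma> \<in> perms (m + 1)"
    and "std m (glue m \<pi> \<sigma>) = \<pi>"
    and "std m (window 2 (glue m \<pi> \<sigma>)) = \<sigma>"
proof -
  define B where "B = insert 0 {2 * \<pi> (i + 1) |i. i \<in> {1..<m} \<and> \<sigma> i < \<sigma> m}"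
  define y where "y = (\<lambda>i. 2 * \<pi> i)(m + 1 := 1 + Max B)"
  have glue_y: "glue m \<pi> \<sigma> = std (m + 1) y"
    by (simp add: glue_def y_def B_def)
  have inj\<pi>: "inj \<pi>" and inj\<sigma>: "inj \<sigma>"
    using \<pi> \<sigma> by (auto simp: perms_def permutes_inj)
  have "finite {i. i \<in> {1..<m} \<and> \<sigma> i < \<sigma> m}"
    by (rule finite_subset[of _ "{1..<m}"]) auto
  then have finB: "finite B"
    unfolding B_def by simp
  have BNE: "B \<noteq> {}"
    by (simp add: B_def)
  have "Max B \<in> B"
    using finB BNE by (rule Max_in)
  then have "even (Max B)"
    unfolding B_def by auto
  then have odd: "odd (y (m + 1))"
    by (simp add: y_def)
  have even: "y i = 2 * \<pi> i" if "i \<in> {1..m}" for i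
    using that by (simp add: y_def)
  \<comment> \<open>The value \<open>1 + Max B\<close> cuts the places \<open>2, \<dots>, m\<close> exactly where \<open>\<sigma>\<close> requires it.\<close>
  have cut: "y (i + 1) < y (m + 1) \<longleftrightarrow> \<sigma> i < \<sigma> m" if i: "i \<in> {1..<m}" for i
  proof
    assume "\<sigma> i < \<sigma> m"
    with i have "2 * \<pi> (i + 1) \<in> B"
      unfolding B_def by blast
    then have "2 * \<pi> (i + 1) \<le> Max B"
      using finB by simp
    with i show "y (i + 1) < y (m + 1)"
      by (simp add: y_def)
  next
    assume less: "y (i + 1) < y (m + 1)"
    show "\<sigma> i < \<sigma> m"
    proof (rule ccontr)
      assume not: "\<not> \<sigma> i < \<sigma> m"
      have "b < 2 * \<pi> (i + 1)" if "b \<in> B" for b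
      proof -
        have "\<pi> (i + 1) \<in> {1..m}"
          using \<pi> i by (subst permutes_in_image[of \<pi> "{1..m}"]) (auto simp: perms_def)
        moreover have "\<pi> (j + 1) < \<pi> (i + 1)" if j: "j \<in> {1..<m}" "\<sigma> j < \<sigma> m" for j
        proof -
          have "shows_pattern (m - 1) \<sigma> (std (m - 1) (window 2 \<pi>))"
            using shows_pattern_std overlap by metis
          moreover have "\<sigma> j < \<sigma> i"
            using j not by simp
          moreover have "i \<in> {1..m - 1}" "j \<in> {1..m - 1}"
            using i j by auto
          ultimately have "window 2 \<pi> j < window 2 \<pi> i"
            using shows_pattern_std[of "m - 1" "window 2 \<pi>"]
            unfolding shows_pattern_def by blast
          then show ?thesis
            by (simp add: numeral_2_eq_2)
        qed
        ultimately show ?thesis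
          using that by (auto simp: B_def)
      qed
      then have "Max B < 2 * \<pi> (i + 1)"
        using finB BNE by simp
      with less i show False
        by (simp add: y_def)
    qed
  qed
  have "y i \<noteq> y j" if "i < j" "i \<in> {1..m + 1}" "j \<in> {1..m + 1}" for i j
  proof (cases "j = m + 1")
    case True
    with that have "even (y i)"
      by (subst even) auto
    with odd True show ?thesis
      by auto
  next
    case False
    then show ?thesis
      using that even inj\<pi> by (auto dest: injD)
  qed
  then have inj: "inj_on y {1..m + 1}"
    by (rule linorder_inj_onI) (assumption+ | rule linear)+
  then show "glue m \<pi> \<sigma> \<in> perms (m + 1)"
    unfolding glue_y by (rule std_in_perms)
  have "std m (glue m \<pi> \<sigma>) = std m y"
    using std_window_std[of 1 m "m + 1" y] by (simp add: glue_y)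
  also have "\<dots> = \<pi>"
    by (subst shows_pattern_iff_std[OF \<pi>, symmetric]) (simp add: shows_pattern_def even)
  finally show "std m (glue m \<pi> \<sigma>) = \<pi>" .
  have "shows_pattern m (window 2 y) \<sigma>"
    unfolding shows_pattern_def
  proof (intro ballI)
    fix i j assume i: "i \<in> {1..m}" and j: "j \<in> {1..m}"
    have flip: "b < a \<longleftrightarrow> d < c" if "a < b \<longleftrightarrow> c < d" "b \<noteq> a" "d \<noteq> c" for a b c d :: nat
      using that by arith
    have *: "2 + i - 1 = i + 1" "2 + j - 1 = j + 1"
      by simp_all
    have neq: "y (m + 1) \<noteq> y (l + 1)" "\<sigma> m \<noteq> \<sigma> l" if "l \<in> {1..<m}" for l
    proof -
      have "m + 1 \<noteq> l + 1" "m + 1 \<in> {1..m + 1}" "l + 1 \<in> {1..m + 1}" "m \<noteq> l"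
        using that by auto
      with inj inj\<sigma> show "y (m + 1) \<noteq> y (l + 1)" "\<sigma> m \<noteq> \<sigma> l"
        by (auto simp only: inj_on_eq_iff inj_eq)
    qed
    show "y (2 + i - 1) < y (2 + j - 1) \<longleftrightarrow> \<sigma> i < \<sigma> j"
      unfolding *
    proof -
      consider "i = m" "j = m" | "i < m" "j = m" | "i = m" "j < m" | "i < m" "j < m"
        using i j by fastforce
      then show "y (i + 1) < y (j + 1) \<longleftrightarrow> \<sigma> i < \<sigma> j"
      proof cases
        case 1
        then show ?thesis by simp
      next
        case 2
        then show ?thesis using cut[of i] i by simp
      next
        case 3
        then have "j \<in> {1..<m}"
          using j by simp
        then show ?thesis
          using flip[OF cut neq] 3 by simp
      next
        case 4
        then have "i \<in> {1..m - 1}" "j \<in> {1..m - 1}"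
          using i j by auto
        then have "\<sigma> i < \<sigma> j \<longleftrightarrow> window 2 \<pi> i < window 2 \<pi> j"
          using shows_pattern_std[of "m - 1" "window 2 \<pi>"] shows_pattern_std[of "m - 1" \<sigma>] overlap
          unfolding shows_pattern_def overlap by blast
        moreover have "2 + i - 1 = i + 1" "2 + j - 1 = j + 1"
          by simp_all
        ultimately show ?thesis
          using 4 even[of "i + 1"] even[of "j + 1"] by simp
      qed
    qed
  qed
  then have "std m (window 2 y) = \<sigma>"
    using \<sigma> shows_pattern_iff_std by blast
  then show "std m (window 2 (glue m \<pi> \<sigma>)) = \<sigma>"
    using std_window_std[of 2 m "m + 1" y] by (simp add: glue_y)
qed

text \<open>
  By stationarity the first \<open>m - 1\<close> and the last \<open>m - 1\<close> letters of a \<open>Q\<close>-random permutation show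
  the same random pattern. So one can draw \<open>\<pi>\<close> from \<open>Q\<close>, then \<open>\<sigma>\<close> from \<open>Q\<close> conditioned on its head
  being the tail of \<open>\<pi>\<close>, as in one step of a Markov chain with invariant law \<open>Q\<close>, and \<open>\<sigma>\<close> has law
  \<open>Q\<close> as well. Glueing the two gives a permutation of length \<open>m + 1\<close> whose first and last windows
  of length \<open>m\<close> both have law \<open>Q\<close>. Every shorter window lies in one of these two, so its law is
  inherited from \<open>Q\<close>.
\<close>

lemma stationary_extension:
  assumes m: "1 \<le> m" and st: "stationary_perm_pmf m Q"
  obtains Q' where "stationary_perm_pmf (m + 1) Q'" "map_pmf (std m) Q' = Q"
proof -
  define head where "head = (\<lambda>\<pi>. std (m - 1) \<pi>)"
  define tail where "tail = (\<lambda>\<pi>. std (m - 1) (window 2 \<pi>))"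
  have supp: "set_pmf Q \<subseteq> perms m"
    using st by (simp add: stationary_perm_pmf_def)
  have eq_law: "map_pmf head Q = map_pmf tail Q"
  proof -
    have "map_pmf (\<lambda>\<pi>. std (m - 1) (window 1 \<pi>)) Q = map_pmf tail Q"
    proof -
      have "m - 1 < m" "1 \<in> {1..m + 1 - (m - 1)}" "2 \<in> {1..m + 1 - (m - 1)}"
        using m by auto
      with st show ?thesis
        unfolding stationary_iff_map_pmf tail_def by blast
    qed
    then show ?thesis
      by (simp add: head_def)
  qed
  have eq_set: "head ` set_pmf Q = tail ` set_pmf Q"
    using arg_cong[OF eq_law, of set_pmf] by simp
  have ne: "set_pmf Q \<inter> {\<sigma>. head \<sigma> = tail \<pi>} \<noteq> {}" if "\<pi> \<in> set_pmf Q" for \<pi>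
  proof -
    have "tail \<pi> \<in> head ` set_pmf Q"
      using that eq_set by blast
    then show ?thesis
      by auto
  qed
  define N where "N = (\<lambda>\<pi>. cond_pmf Q {\<sigma>. head \<sigma> = tail \<pi>})"
  have set_N: "set_pmf (N \<pi>) = set_pmf Q \<inter> {\<sigma>. head \<sigma> = tail \<pi>}" if "\<pi> \<in> set_pmf Q" for \<pi>
    unfolding N_def by (rule set_cond_pmf[OF ne[OF that]])
  \<comment> \<open>\<open>Q\<close> is invariant under the kernel, as head and tail have equal laws.\<close>
  have bind_N: "bind_pmf Q N = Q"
    unfolding N_def
  proof (rule bind_cond_pmf_cancel)
    fix \<sigma> assume "\<sigma> \<in> set_pmf Q"
    then have "head \<sigma> \<in> tail ` set_pmf Q"
      using eq_set by blast
    then show "set_pmf Q \<inter> {\<pi>. head \<sigma> = tail \<pi>} \<noteq> {}"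
      by auto
  next
    fix \<pi> \<sigma> assume "head \<sigma> = tail \<pi>"
    then have "measure Q {\<sigma>. head \<sigma> = tail \<pi>} = pmf (map_pmf head Q) (tail \<pi>)"
      "measure Q {\<pi>. head \<sigma> = tail \<pi>} = pmf (map_pmf tail Q) (tail \<pi>)"
      by (auto simp: pmf_map vimage_def intro!: arg_cong[where f = "measure Q"])
    with eq_law show "measure Q {\<sigma>. head \<sigma> = tail \<pi>} = measure Q {\<pi>. head \<sigma> = tail \<pi>}"
      by simp
  qed (use ne in auto)
  define Q' where "Q' = bind_pmf Q (\<lambda>\<pi>. map_pmf (glue m \<pi>) (N \<pi>))"
  have gl: "glue m \<pi> \<sigma> \<in> perms (m + 1)" "std m (glue m \<pi> \<sigma>) = \<pi>"
    "std m (window 2 (glue m \<pi> \<sigma>)) = \<sigma>"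
    if "\<pi> \<in> set_pmf Q" "\<sigma> \<in> set_pmf (N \<pi>)" for \<pi> \<sigma>
    using glue_patterns[OF m, of \<pi> \<sigma>] that supp by (auto simp: set_N head_def tail_def)
  have supp': "set_pmf Q' \<subseteq> perms (m + 1)"
    unfolding Q'_def using gl(1) by (simp only: set_bind_pmf set_map_pmf) blast
  have first: "map_pmf (std m) Q' = Q"
  proof -
    have "map_pmf (std m) Q' = bind_pmf Q (\<lambda>\<pi>. map_pmf (\<lambda>\<sigma>. std m (glue m \<pi> \<sigma>)) (N \<pi>))"
      by (simp add: Q'_def map_bind_pmf map_pmf_comp)
    also have "\<dots> = bind_pmf Q return_pmf"
    proof (intro bind_pmf_cong refl)
      fix \<pi> assume \<pi>: "\<pi> \<in> set_pmf Q"
      have "map_pmf (\<lambda>\<sigma>. std m (glue m \<pi> \<sigma>)) (N \<pi>) = map_pmf (\<lambda>_. \<pi>) (N \<pi>)"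
        by (rule pmf.map_cong) (auto simp: gl[OF \<pi>])
      then show "map_pmf (\<lambda>\<sigma>. std m (glue m \<pi> \<sigma>)) (N \<pi>) = return_pmf \<pi>"
        by simp
    qed
    finally show ?thesis
      by (simp add: bind_return_pmf')
  qed
  have last: "map_pmf (\<lambda>\<pi>. std m (window 2 \<pi>)) Q' = Q"
  proof -
    have "map_pmf (\<lambda>\<pi>. std m (window 2 \<pi>)) Q' =
        bind_pmf Q (\<lambda>\<pi>. map_pmf (\<lambda>\<sigma>. std m (window 2 (glue m \<pi> \<sigma>))) (N \<pi>))"
      by (simp add: Q'_def map_bind_pmf map_pmf_comp)
    also have "\<dots> = bind_pmf Q N"
      by (intro bind_pmf_cong refl map_pmf_idI gl)
    finally show ?thesis
      by (simp add: bind_N)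
  qed
  have law: "map_pmf (\<lambda>\<pi>. std k (window s \<pi>)) Q' = map_pmf (std k) Q"
    if k: "k < m + 1" and s: "s \<in> {1..m + 1 + 1 - k}" for k s
  proof (cases "s + k \<le> m + 1")
    case True
    have "map_pmf (\<lambda>\<pi>. std k (window s \<pi>)) Q' =
        map_pmf (\<lambda>\<pi>. std k (window s \<pi>)) (map_pmf (std m) Q')"
    proof -
      have "std k (window s (std m \<pi>)) = std k (window s \<pi>)" for \<pi>
        using True s by (intro std_window_std) auto
      then show ?thesis
        by (simp only: map_pmf_comp)
    qed
    also have "\<dots> = map_pmf (\<lambda>\<pi>. std k (window s \<pi>)) Q"
      by (simp only: first)
    also have "\<dots> = map_pmf (\<lambda>\<pi>. std k (window 1 \<pi>)) Q"
    proof (cases "k = m")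
      case True
      with \<open>s + k \<le> m + 1\<close> s have "s = 1"
        by simp
      then show ?thesis
        by simp
    next
      case False
      with k True s have "k < m" "s \<in> {1..m + 1 - k}" "1 \<in> {1..m + 1 - k}"
        by auto
      with st show ?thesis
        unfolding stationary_iff_map_pmf by blast
    qed
    finally show ?thesis
      by simp
  next
    \<comment> \<open>The window ends at the last letter, hence sits at \<open>s - 1\<close> within the last \<open>m\<close> letters.\<close>
    case False
    with s k have s: "s + k = m + 2" "2 \<le> s"
      by auto
    have "map_pmf (\<lambda>\<pi>. std k (window s \<pi>)) Q' =
        map_pmf (\<lambda>\<pi>. std k (window (s - 1) \<pi>)) (map_pmf (\<lambda>\<pi>. std m (window 2 \<pi>)) Q')"
    proof -
      have "std k (window (s - 1) (std m (window 2 \<pi>))) = std k (window s \<pi>)" for \<pi>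
      proof -
        have "window (s - 1) (window 2 \<pi>) = window s \<pi>" if "2 \<le> s" for \<pi> :: "nat \<Rightarrow> nat"
          using that by (auto simp: fun_eq_iff intro!: arg_cong[where f = \<pi>])
        then have "window (s - 1) (window 2 \<pi>) = window s \<pi>"
          using s(2) .
        moreover have "std k (window (s - 1) (std m (window 2 \<pi>))) = std k (window (s - 1) (window 2 \<pi>))"
          using s by (intro std_window_std) auto
        ultimately show ?thesis
          by (simp only:)
      qed
      then show ?thesis
        by (simp only: map_pmf_comp)
    qed
    also have "\<dots> = map_pmf (\<lambda>\<pi>. std k (window (s - 1) \<pi>)) Q"
      by (simp only: last)
    also have "\<dots> = map_pmf (\<lambda>\<pi>. std k (window 1 \<pi>)) Q"
    proof (cases "k = m")
      case True
      with s have "s - 1 = 1"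
        by simp
      then show ?thesis
        by simp
    next
      case False
      with k s have "k < m" "s - 1 \<in> {1..m + 1 - k}" "1 \<in> {1..m + 1 - k}"
        by auto
      with st show ?thesis
        unfolding stationary_iff_map_pmf by blast
    qed
    finally show ?thesis
      by simp
  qed
  have "stationary_perm_pmf (m + 1) Q'"
    unfolding stationary_iff_map_pmf using supp' law by simp
  with first show ?thesis
    by (rule that[rotated])
qed

section \<open>Inverse limits of discrete laws\<close>

text \<open>
  A consistent sequence of discrete laws is realized by a Markov chain: given the value at time \<open>n\<close>,
  the next value is drawn from the next law conditioned on projecting to the current value. The
  Ionescu-Tulcea theorem provides the chain. Almost every path is consistent, and restricting to
  these paths makes the consistency hold everywhere, so that no exceptional set remains for later
  constructions on the paths.
\<close>

lemma pmf_inverse_limit: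
  fixes Q :: "nat \<Rightarrow> 'a pmf" and f :: "nat \<Rightarrow> 'a \<Rightarrow> 'a"
  assumes proj: "\<And>n. map_pmf (f n) (Q (Suc n)) = Q n"
  obtains M :: "(nat \<Rightarrow> 'a) measure" where "prob_space M"
    and "\<And>n. (\<lambda>\<omega>. \<omega> n) \<in> measurable M (count_space UNIV)"
    and "\<And>n. distr M (count_space UNIV) (\<lambda>\<omega>. \<omega> n) = measure_pmf (Q n)"
    and "\<And>\<omega> n. \<omega> \<in> space M \<Longrightarrow> \<omega> n \<in> set_pmf (Q n)"
    and "\<And>\<omega> n. \<omega> \<in> space M \<Longrightarrow> f n (\<omega> (Suc n)) = \<omega> n"
proof -
  \<comment> \<open>Off the support the condition may be void; any law will do there.\<close>
  define K where "K n x = (if x \<in> set_pmf (Q n) then cond_pmf (Q (Suc n)) {y. f n y = x}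
    else return_pmf undefined)" for n x
  have img: "f n ` set_pmf (Q (Suc n)) = set_pmf (Q n)" for n
    using proj[of n] by (metis set_map_pmf)
  have ne: "set_pmf (Q (Suc n)) \<inter> {y. f n y = x} \<noteq> {}" if "x \<in> set_pmf (Q n)" for n x
  proof -
    have "x \<in> f n ` set_pmf (Q (Suc n))"
      using that img by simp
    then show ?thesis
      by auto
  qed
  have set_K: "set_pmf (K n x) = set_pmf (Q (Suc n)) \<inter> {y. f n y = x}" if "x \<in> set_pmf (Q n)" for n x
    using that by (simp add: K_def set_cond_pmf[OF ne])
  have bind_K: "bind_pmf (Q n) (K n) = Q (Suc n)" for n
  proof -
    have "bind_pmf (Q n) (K n) = bind_pmf (Q n) (\<lambda>x. cond_pmf (Q (Suc n)) {y. f n y = x})"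
      by (rule bind_pmf_cong) (auto simp: K_def)
    also have "\<dots> = Q (Suc n)"
    proof (rule bind_cond_pmf_cancel)
      fix x y assume "f n y = x"
      then have "measure (Q (Suc n)) {y. f n y = x} = pmf (map_pmf (f n) (Q (Suc n))) x"
        by (simp add: pmf_map vimage_def)
      also have "\<dots> = measure (Q n) {x. f n y = x}"
        using \<open>f n y = x\<close> by (simp add: proj measure_pmf_single)
      finally show "measure (Q (Suc n)) {y. f n y = x} = measure (Q n) {x. f n y = x}" .
    next
      fix y assume "y \<in> set_pmf (Q (Suc n))"
      then have "f n y \<in> set_pmf (Q n)"
        using img by blast
      then show "set_pmf (Q n) \<inter> {x. f n y = x} \<noteq> {}"
        by simp
    qed (rule ne)
    finally show ?thesis .
  qed
  define P where "P n \<omega> = measure_pmf (case n of 0 \<Rightarrow> Q 0 | Suc l \<Rightarrow> K l (\<omega> l))"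
    for n and \<omega> :: "nat \<Rightarrow> 'a"
  have P_0: "P 0 \<omega> = measure_pmf (Q 0)" and P_Suc: "P (Suc n) \<omega> = measure_pmf (K n (\<omega> n))" for n \<omega>
    by (simp_all add: P_def)
  let ?S = "\<lambda>_ :: nat. count_space (UNIV :: 'a set)"
  have P_meas: "P i \<in> measurable (PiM {0..<i} ?S) (subprob_algebra (count_space UNIV))" for i
  proof (cases i)
    case 0
    have "P i = (\<lambda>_. measure_pmf (Q 0))"
      using 0 by (simp add: P_def fun_eq_iff)
    then show ?thesis
      using measure_pmf_in_subprob_space[of "Q 0"] by simp
  next
    case (Suc l)
    have "(\<lambda>\<omega>. measure_pmf (K l (\<omega> l))) \<in>
        measurable (PiM {0..<i} ?S) (subprob_algebra (count_space UNIV))"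
      using Suc by (intro measurable_compose[OF _ measurable_measure_pmf]
        measurable_component_singleton[of l _ ?S]) simp
    with Suc show ?thesis
      by (simp add: P_def[abs_def])
  qed
  interpret IT: Ionescu_Tulcea P ?S
    by (rule Ionescu_Tulcea.intro) (rule P_meas, simp add: P_def prob_space_measure_pmf)
  let ?u = "\<lambda>_ :: nat. undefined :: 'a"
  have u: "?u \<in> space (PiM {0..<0} ?S)"
    by (simp add: space_PiM)
  have comp_fin: "(\<lambda>\<omega>. \<omega> n) \<in> measurable (PiM {0..<N} ?S) (count_space UNIV)" if "n < N" for n N
    using that by (intro measurable_component_singleton) simp
  have upd: "fun_upd \<omega> n \<in> measurable (P n \<omega>) (PiM {0..<Suc n} ?S)"
    if \<omega>: "\<omega> \<in> space (PiM {0..<n} ?S)" for n \<omega>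
  proof (rule measurable_fun_upd)
    show "{0..<Suc n} = {0..<n} \<union> {n}"
      by auto
    show "(\<lambda>_. \<omega>) \<in> measurable (P n \<omega>) (PiM {0..<n} ?S)"
      using \<omega> by simp
    show "(\<lambda>x. x) \<in> measurable (P n \<omega>) (count_space UNIV)"
      by (simp add: P_def)
  qed
  have law_eP: "distr (IT.eP n \<omega>) (count_space UNIV) (\<lambda>\<omega>. \<omega> n) = P n \<omega>"
    if \<omega>: "\<omega> \<in> space (PiM {0..<n} ?S)" for n \<omega>
    unfolding IT.eP_def
    by (subst distr_distr[OF comp_fin upd[OF \<omega>]]) (simp_all add: o_def P_def distr_id2)
  have sets_C: "sets (IT.C 0 n ?u) = sets (PiM {0..<n} ?S)" for n
    using IT.sets_C[OF u, of n] by (simp only: add_0)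
  have space_C: "space (IT.C 0 n ?u) = space (PiM {0..<n} ?S)" for n
    using IT.space_C[OF u, of n] by (simp only: add_0)
  have eP_meas: "IT.eP n \<in> measurable (IT.C 0 n ?u) (subprob_algebra (PiM {0..<Suc n} ?S))" for n
    using IT.measurable_eP[of n] by (simp only: measurable_cong_sets[OF sets_C refl])
  have C_Suc: "IT.C 0 (Suc n) ?u = IT.C 0 n ?u \<bind> IT.eP n" for n
    by simp
  have comp_C: "(\<lambda>\<omega>. \<omega> n) \<in> measurable (IT.C 0 N ?u) (count_space UNIV)" if "n < N" for n N
    unfolding measurable_cong_sets[OF sets_C refl] using that by (rule comp_fin)
  have law_C: "distr (IT.C 0 (Suc n) ?u) (count_space UNIV) (\<lambda>\<omega>. \<omega> n) = measure_pmf (Q n)" for n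
  proof (induction n)
    case 0
    have "IT.C 0 (Suc 0) ?u = IT.eP 0 ?u"
      using bind_return[OF IT.measurable_eP u] by simp
    then show ?case
      using law_eP[OF u] P_0 by simp
  next
    case (Suc n)
    let ?C = "IT.C 0 (Suc n) ?u"
    have neC: "space ?C \<noteq> {}"
      unfolding space_C by (simp add: space_PiM_empty_iff)
    have "distr (IT.C 0 (Suc (Suc n)) ?u) (count_space UNIV) (\<lambda>\<omega>. \<omega> (Suc n)) =
        ?C \<bind> (\<lambda>\<omega>. distr (IT.eP (Suc n) \<omega>) (count_space UNIV) (\<lambda>\<omega>. \<omega> (Suc n)))"
      unfolding C_Suc[of "Suc n"] by (rule distr_bind[OF eP_meas neC comp_fin]) simp
    also have "\<dots> = ?C \<bind> (\<lambda>\<omega>. measure_pmf (K n (\<omega> n)))"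
      by (rule bind_cong[OF refl]) (simp only: space_C law_eP P_Suc)
    also have "\<dots> = distr ?C (count_space UNIV) (\<lambda>\<omega>. \<omega> n) \<bind> (\<lambda>x. measure_pmf (K n x))"
      by (rule bind_distr[symmetric, OF comp_C measurable_measure_pmf neC]) simp
    also have "\<dots> = measure_pmf (Q (Suc n))"
      unfolding Suc.IH by (simp add: measure_pmf_bind[symmetric] bind_K)
    finally show ?case .
  qed
  \<comment> \<open>The type of values may be uncountable, and then equality of two coordinates is in general not
    measurable. Naming the value inside the countable support keeps the event measurable.\<close>
  define good where "good n \<omega> \<longleftrightarrow> (\<exists>y\<in>set_pmf (Q (Suc n)). \<omega> (Suc n) = y \<and> \<omega> n = f n y)"
    for n \<omega>
  have pred_good: "Measurable.pred N (good n)"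
    if "\<And>i. i \<le> Suc n \<Longrightarrow> (\<lambda>\<omega>. \<omega> i) \<in> measurable N (count_space UNIV)"
    for N :: "(nat \<Rightarrow> 'a) measure" and n
  proof -
    have "Measurable.pred N (\<lambda>\<omega>. \<omega> (Suc n) = y \<and> \<omega> n = f n y)" for y
      by (intro pred_intros_logic(3) measurable_compose[OF that, of _ "\<lambda>x. x = _"]) simp_all
    then show ?thesis
      unfolding good_def[abs_def] pred_def
      by (intro sets.sets_Collect_countable_Ex') (simp_all add: countable_set_pmf)
  qed
  have step: "AE \<omega> in IT.C 0 (Suc (Suc n)) ?u. good n \<omega>" for n
  proof -
    have pg: "Measurable.pred (PiM {0..<Suc (Suc n)} ?S) (good n)"
      by (rule pred_good) (auto intro: comp_fin)
    have "AE x in measure_pmf (Q n). x \<in> set_pmf (Q n)"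
      by (simp add: AE_measure_pmf)
    then have "AE \<omega> in IT.C 0 (Suc n) ?u. \<omega> n \<in> set_pmf (Q n)"
      unfolding law_C[symmetric] by (rule AE_distrD[rotated]) (rule comp_C, simp)
    then have "AE \<omega> in IT.C 0 (Suc n) ?u. AE \<omega>' in IT.eP (Suc n) \<omega>. good n \<omega>'"
    proof (rule AE_mp[OF _ AE_I2], intro impI)
      fix \<omega> assume "\<omega> \<in> space (IT.C 0 (Suc n) ?u)" and \<omega>n: "\<omega> n \<in> set_pmf (Q n)"
      then have \<omega>: "\<omega> \<in> space (PiM {0..<Suc n} ?S)"
        by (simp only: space_C)
      have "AE x in P (Suc n) \<omega>. good n (fun_upd \<omega> (Suc n) x)"
        unfolding P_Suc AE_measure_pmf_iff using set_K[OF \<omega>n] by (auto simp: good_def)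
      then show "AE \<omega>' in IT.eP (Suc n) \<omega>. good n \<omega>'"
        unfolding IT.eP_def using pg by (subst AE_distr_iff[OF upd[OF \<omega>]]) auto
    qed
    then show ?thesis
      unfolding C_Suc[of "Suc n"] by (subst AE_bind[OF eP_meas pg])
  qed
  define M where "M = IT.PF.lim"
  have sets_M: "sets M = sets (PiM UNIV ?S)" 
    unfolding M_def by (rule IT.PF.sets_lim)
  have meas_M[measurable]: "(\<lambda>\<omega>. \<omega> n) \<in> measurable M (count_space UNIV)" for n
    using measurable_component_singleton[of n UNIV ?S] by (simp add: measurable_cong_sets[OF sets_M refl])
  have restr: "distr M (PiM {0..<N} ?S) (\<lambda>\<omega>. restrict \<omega> {0..<N}) = IT.C 0 N ?u" for N
  proof -
    have "IT.up_to {0..<N} = N"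
      by (rule antisym) (use IT.up_to[of "{0..<N}"] in \<open>auto simp: IT.up_to_iff\<close>)
    then have "IT.CI {0..<N} = distr (IT.C 0 N ?u) (PiM {0..<N} ?S) (\<lambda>\<omega>. restrict \<omega> {0..<N})"
      by (simp only: IT.CI_def)
    also have "\<dots> = IT.C 0 N ?u"
      using IT.distr_C[OF order_refl u, of N] by (simp only: add_0)
    finally show ?thesis
      unfolding M_def using IT.distr_lim[of "{0..<N}"] by simp
  qed
  have restr_meas: "(\<lambda>\<omega>. restrict \<omega> {0..<N}) \<in> measurable M (PiM {0..<N} ?S)" for N
    unfolding measurable_cong_sets[OF sets_M refl] by (rule measurable_restrict_subset) simp
  have prob_M: "prob_space M"
  proof -
    have "prob_space (IT.C 0 0 ?u)"
      by (rule IT.prob_space_C[OF u])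
    then show ?thesis
      unfolding restr[symmetric] by (rule prob_space_distrD[OF restr_meas])
  qed
  have law_M: "distr M (count_space UNIV) (\<lambda>\<omega>. \<omega> n) = measure_pmf (Q n)" for n
    unfolding law_C[of n, symmetric] restr[of "Suc n", symmetric]
    by (subst distr_distr) (auto simp: comp_fin restr_meas o_def)
  interpret M: prob_space M by (rule prob_M)
  define G where "G = {\<omega> \<in> space M. \<forall>n. good n \<omega>}"
  have "Measurable.pred M (good n)" for n
    by (rule pred_good) (rule meas_M)
  then have G_sets: "G \<in> sets M"
    unfolding G_def by (intro sets.sets_Collect_countable_All) (simp add: pred_def)
  have "AE \<omega> in M. good n \<omega>" for n
  proof -
    have "AE \<omega> in M. good n (restrict \<omega> {0..<Suc (Suc n)})"
      using step[of n] unfolding restr[symmetric] by (rule AE_distrD[OF restr_meas])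
    then show ?thesis
      by (simp add: good_def)
  qed
  then have "AE \<omega> in M. \<forall>n. good n \<omega>"
    by (simp add: AE_all_countable)
  then have G_AE: "AE \<omega> in M. \<omega> \<in> G"
    by (rule AE_mp[OF _ AE_I2]) (simp add: G_def)
  have G_inter: "G \<inter> space M \<in> sets M"
    using G_sets by (rule sets.Int) simp
  show ?thesis
  proof (rule that[of "restrict_space M G"])
    show meas: "(\<lambda>\<omega>. \<omega> n) \<in> measurable (restrict_space M G) (count_space UNIV)" for n
      by (rule measurable_restrict_space1[OF meas_M])
    show "prob_space (restrict_space M G)"
    proof (rule prob_space_restrict_space)
      show "emeasure M G = 1"
        by (rule M.emeasure_eq_1_AE[OF G_sets G_AE])
    qed (rule G_sets)
    show "distr (restrict_space M G) (count_space UNIV) (\<lambda>\<omega>. \<omega> n) = measure_pmf (Q n)" for n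
      unfolding law_M[symmetric]
    proof (rule measure_eqI)
      fix A :: "'a set"
      have "emeasure (distr (restrict_space M G) (count_space UNIV) (\<lambda>\<omega>. \<omega> n)) A =
          emeasure (restrict_space M G) ((\<lambda>\<omega>. \<omega> n) -` A \<inter> G)"
        using G_sets[THEN sets.sets_into_space]
        by (simp add: emeasure_distr[OF meas] space_restrict_space Int_absorb1 Int_absorb2)
      also have "\<dots> = emeasure M ((\<lambda>\<omega>. \<omega> n) -` A \<inter> G)"
        by (rule emeasure_restrict_space[OF G_inter]) blast
      also have "\<dots> = emeasure M ((\<lambda>\<omega>. \<omega> n) -` A \<inter> space M)"
      proof (rule emeasure_eq_AE)
        have A: "(\<lambda>\<omega>. \<omega> n) -` A \<inter> space M \<in> sets M"
          by (rule measurable_sets[OF meas_M]) simp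
        then show "(\<lambda>\<omega>. \<omega> n) -` A \<inter> space M \<in> sets M" .
        have "(\<lambda>\<omega>. \<omega> n) -` A \<inter> G = ((\<lambda>\<omega>. \<omega> n) -` A \<inter> space M) \<inter> G"
          using G_sets[THEN sets.sets_into_space] by blast
        with A G_sets show "(\<lambda>\<omega>. \<omega> n) -` A \<inter> G \<in> sets M"
          by (simp only: sets.Int)
        show "AE \<omega> in M. \<omega> \<in> (\<lambda>\<omega>. \<omega> n) -` A \<inter> G \<longleftrightarrow> \<omega> \<in> (\<lambda>\<omega>. \<omega> n) -` A \<inter> space M"
          using G_AE by (rule AE_mp[OF _ AE_I2]) simp
      qed
      also have "\<dots> = emeasure (distr M (count_space UNIV) (\<lambda>\<omega>. \<omega> n)) A"
        by (simp add: emeasure_distr[OF meas_M])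
      finally show "emeasure (distr (restrict_space M G) (count_space UNIV) (\<lambda>\<omega>. \<omega> n)) A =
          emeasure (distr M (count_space UNIV) (\<lambda>\<omega>. \<omega> n)) A" .
    qed simp
    show "\<omega> n \<in> set_pmf (Q n)" "f n (\<omega> (Suc n)) = \<omega> n" if "\<omega> \<in> space (restrict_space M G)" for \<omega> n
    proof -
      have "good n \<omega>"
        using that by (simp add: space_restrict_space G_def)
      then obtain y where "y \<in> set_pmf (Q (Suc n))" "\<omega> (Suc n) = y" "\<omega> n = f n y"
        unfolding good_def by blast
      then show "\<omega> n \<in> set_pmf (Q n)" "f n (\<omega> (Suc n)) = \<omega> n"
        using img by auto
    qed
  qed
qed

section \<open>Patterns in orders\<close>

text \<open>Counting predecessors among the first \<open>n\<close> objects embeds their order into the numbers.\<close>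

definition order_pattern :: "nat \<Rightarrow> (nat \<times> nat) set \<Rightarrow> nat \<Rightarrow> nat" where
  "order_pattern n r = std n (\<lambda>i. card {j \<in> {1..n}. (j, i) \<in> r})"

lemma order_pattern_less_iff:
  assumes r: "r \<in> nat_orders" and ij: "i \<in> {1..n}" "j \<in> {1..n}"
  shows "order_pattern n r i < order_pattern n r j \<longleftrightarrow> (i, j) \<in> r"
proof -
  have tr: "trans r" and irr: "irrefl r" and tot: "total_on {1..} r"
    using r by (auto simp: nat_orders_def strict_linear_order_on_def)
  let ?D = "\<lambda>i. {l \<in> {1..n}. (l, i) \<in> r}"
  have sub: "?D a \<subset> ?D b" if "(a, b) \<in> r" "a \<in> {1..n}" for a b
  proof -
    have "a \<in> ?D b - ?D a"
      using that irr by (simp add: irrefl_def)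
    moreover have "?D a \<subseteq> ?D b"
      using transD[OF tr _ that(1)] by blast
    ultimately show ?thesis
      by blast
  qed
  have less: "card (?D a) < card (?D b)" if "(a, b) \<in> r" "a \<in> {1..n}" for a b
    by (rule psubset_card_mono[OF _ sub[OF that]]) simp
  have "card (?D i) < card (?D j) \<longleftrightarrow> (i, j) \<in> r"
  proof (cases "i = j")
    case True
    with irr show ?thesis
      by (simp add: irrefl_def)
  next
    case False
    then have "(i, j) \<in> r \<or> (j, i) \<in> r"
      using tot ij by (simp add: total_on_def)
    then show ?thesis
      using less[of i j] less[of j i] ij by fastforce
  qed
  then show ?thesis
    using shows_pattern_std[of n "\<lambda>i. card (?D i)"] ij
    unfolding shows_pattern_def order_pattern_def by blast
qed

lemma order_pattern_in_perms:
  assumes r: "r \<in> nat_orders"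
  shows "order_pattern n r \<in> perms n"
  unfolding order_pattern_def
proof (rule std_in_perms, rule inj_onI, rule ccontr)
  fix i j
  assume ij: "i \<in> {1..n}" "j \<in> {1..n}" and "i \<noteq> j"
    and eq: "card {l \<in> {1..n}. (l, i) \<in> r} = card {l \<in> {1..n}. (l, j) \<in> r}"
  have "total_on {1..} r"
    using r by (auto simp: nat_orders_def strict_linear_order_on_def)
  with ij \<open>i \<noteq> j\<close> have "(i, j) \<in> r \<or> (j, i) \<in> r"
    by (simp add: total_on_def)
  then have "order_pattern n r i < order_pattern n r j \<or> order_pattern n r j < order_pattern n r i"
    using order_pattern_less_iff[OF r] ij by blast
  moreover have "order_pattern n r i = order_pattern n r j"
    using eq ij by (simp add: order_pattern_def std_def)
  ultimately show False
    by simp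
qed

lemma objects_show_pattern_iff:
  assumes r: "r \<in> nat_orders" and t: "1 \<le> t" "t + k \<le> n + 1"
    and y: "\<And>i j. i \<in> {1..n} \<Longrightarrow> j \<in> {1..n} \<Longrightarrow> (i, j) \<in> r \<longleftrightarrow> y i < y j"
  shows "objects_show_pattern r t k \<kappa> \<longleftrightarrow> shows_pattern k (window t y) \<kappa>"
proof -
  have "(t + i - 1, t + j - 1) \<in> r \<longleftrightarrow> y (t + i - 1) < y (t + j - 1)"
    if "i \<in> {1..k}" "j \<in> {1..k}" for i j
    using that t by (intro y) auto
  then show ?thesis
    by (simp add: objects_show_pattern_def shows_pattern_def)
qed

text \<open>
  The generators of the \<open>\<sigma>\<close>-algebra only mention windows that begin at object 1. A window further to
  the right lies in such an initial window, and its event is the union of the events of the finitely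
  many initial patterns that contain \<open>\<kappa>\<close> at the right place.
\<close>

lemma pattern_event_in_sets:
  assumes t: "1 \<le> t"
  shows "{r \<in> nat_orders. objects_show_pattern r t k \<kappa>} \<in> sets order_space"
proof -
  \<comment> \<open>The summand 1 ensures \<open>2 \<le> n\<close>, as generators have length at least 2.\<close>
  define n where "n = t + k + 1"
  have n: "2 \<le> n" "t + k \<le> n + 1"
    using t by (auto simp: n_def)
  have pat: "objects_show_pattern r 1 n \<nu> \<longleftrightarrow> order_pattern n r = \<nu>"
    if "r \<in> nat_orders" "\<nu> \<in> perms n" for r \<nu>
  proof -
    have "objects_show_pattern r 1 n \<nu> \<longleftrightarrow> shows_pattern n (window 1 (order_pattern n r)) \<nu>"
      by (rule objects_show_pattern_iff[where n = n])
        (use that in \<open>simp_all only: order_pattern_less_iff order_refl add.commute\<close>)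
    also have "\<dots> \<longleftrightarrow> std n (order_pattern n r) = \<nu>"
      using shows_pattern_iff_std[OF that(2), of "order_pattern n r"] by simp
    finally show ?thesis
      by (simp only: std_perm[OF order_pattern_in_perms[OF that(1)]])
  qed
  have "{r \<in> nat_orders. objects_show_pattern r t k \<kappa>} =
    (\<Union>\<nu>\<in>{\<nu> \<in> perms n. shows_pattern k (window t \<nu>) \<kappa>}. {r \<in> nat_orders. objects_show_pattern r 1 n \<nu>})"
    (is "?L = ?R")
  proof (intro equalityI subsetI)
    fix r assume "r \<in> ?L"
    then have r: "r \<in> nat_orders" and "objects_show_pattern r t k \<kappa>"
      by simp_all
    then have "shows_pattern k (window t (order_pattern n r)) \<kappa>"
      using objects_show_pattern_iff[OF r t n(2) order_pattern_less_iff[OF r, symmetric]] by blast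
    moreover have "order_pattern n r \<in> perms n"
      by (rule order_pattern_in_perms[OF r])
    moreover have "objects_show_pattern r 1 n (order_pattern n r)"
      using pat[OF r calculation(2)] by (rule iffD2) (rule refl)
    ultimately show "r \<in> ?R"
      using r by blast
  next
    fix r assume "r \<in> ?R"
    then obtain \<nu> where \<nu>: "\<nu> \<in> perms n" "shows_pattern k (window t \<nu>) \<kappa>"
      and r: "r \<in> nat_orders" and "objects_show_pattern r 1 n \<nu>"
      by blast
    then have "order_pattern n r = \<nu>"
      using pat by blast
    with \<nu> r show "r \<in> ?L"
      using objects_show_pattern_iff[OF r t n(2) order_pattern_less_iff[OF r, symmetric]] by blast
  qed
  also have "\<dots> \<in> sets order_space"
  proof (rule sets.finite_UN)
    show "finite {\<nu> \<in> perms n. shows_pattern k (window t \<nu>) \<kappa>}"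
      using finite_perms by simp
  next
    fix \<nu> assume "\<nu> \<in> {\<nu> \<in> perms n. shows_pattern k (window t \<nu>) \<kappa>}"
    then have "\<nu> \<in> perms n"
      by simp
    then show "{r \<in> nat_orders. objects_show_pattern r 1 n \<nu>} \<in> sets order_space"
      unfolding order_space_def using n(1) by (intro in_measure_of) blast+
  qed
  finally show ?thesis .
qed

section \<open>Orders from growing permutations\<close>

text \<open>
  For a sequence in which the permutation at index \<open>n\<close> has length at least \<open>n\<close>, the index
  \<open>max i j\<close> is the simplest one at which both \<open>i\<close> and \<open>j\<close> are places. If each permutation extends
  the previous one, every later index gives the same comparison.
\<close>

definition limit_order :: "(nat \<Rightarrow> nat \<Rightarrow> nat) \<Rightarrow> (nat \<times> nat) set" where
  "limit_order \<omega> = {(i, j). 1 \<le> i \<and> 1 \<le> j \<and> \<omega> (max i j) i < \<omega> (max i j) j}"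

lemma limit_order:
  assumes perm: "\<And>n. \<omega> n \<in> perms (m + n)"
    and restr: "\<And>n. std (m + n) (\<omega> (Suc n)) = \<omega> n"
  shows "limit_order \<omega> \<in> nat_orders"
    and "i \<in> {1..m + n} \<Longrightarrow> j \<in> {1..m + n} \<Longrightarrow> (i, j) \<in> limit_order \<omega> \<longleftrightarrow> \<omega> n i < \<omega> n j"
proof -
  have step: "\<omega> (n + d) i < \<omega> (n + d) j \<longleftrightarrow> \<omega> n i < \<omega> n j"
    if ij: "i \<in> {1..m + n}" "j \<in> {1..m + n}" for n d i j
  proof (induction d)
    case (Suc d)
    have "i \<in> {1..m + (n + d)}" "j \<in> {1..m + (n + d)}"
      using ij by auto
    then have "\<omega> (Suc (n + d)) i < \<omega> (Suc (n + d)) j \<longleftrightarrow> \<omega> (n + d) i < \<omega> (n + d) j"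
      using shows_pattern_std[of "m + (n + d)" "\<omega> (Suc (n + d))"]
      unfolding shows_pattern_def restr by blast
    then show ?case
      by (simp only: Suc add_Suc_right)
  qed simp
  have consistent: "\<omega> n i < \<omega> n j \<longleftrightarrow> \<omega> l i < \<omega> l j"
    if "i \<in> {1..m + n}" "j \<in> {1..m + n}" "i \<in> {1..m + l}" "j \<in> {1..m + l}" for n l i j
    using step[of i n j "l - n"] step[of i l j "n - l"] that by (cases "n \<le> l") auto
  show mem: "(i, j) \<in> limit_order \<omega> \<longleftrightarrow> \<omega> n i < \<omega> n j"
    if "i \<in> {1..m + n}" "j \<in> {1..m + n}" for i j n
  proof -
    have "\<omega> (max i j) i < \<omega> (max i j) j \<longleftrightarrow> \<omega> n i < \<omega> n j"
      using that by (intro consistent) auto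
    with that show ?thesis
      by (simp add: limit_order_def)
  qed
  have pos: "1 \<le> i" "1 \<le> j" if "(i, j) \<in> limit_order \<omega>" for i j
    using that by (auto simp: limit_order_def)
  have "trans (limit_order \<omega>)"
  proof (rule transI)
    fix i j l assume ij: "(i, j) \<in> limit_order \<omega>" and jl: "(j, l) \<in> limit_order \<omega>"
    define n where "n = i + j + l"
    have "i \<in> {1..m + n}" "j \<in> {1..m + n}" "l \<in> {1..m + n}"
      using pos[OF ij] pos[OF jl] by (auto simp: n_def)
    then show "(i, l) \<in> limit_order \<omega>"
      using ij jl by (simp only: mem)
  qed
  moreover have "irrefl (limit_order \<omega>)"
    by (simp add: irrefl_def limit_order_def)
  moreover have "total_on {1..} (limit_order \<omega>)"
  proof (rule total_onI)
    fix i j :: nat assume "i \<in> {1..}" "j \<in> {1..}" and "i \<noteq> j"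
    then have ij: "i \<in> {1..m + (i + j)}" "j \<in> {1..m + (i + j)}"
      by auto
    have "inj (\<omega> (i + j))"
      using perm[of "i + j"] unfolding perms_def by (blast intro: permutes_inj)
    with \<open>i \<noteq> j\<close> have "\<omega> (i + j) i \<noteq> \<omega> (i + j) j"
      by (simp add: inj_eq)
    then show "(i, j) \<in> limit_order \<omega> \<or> (j, i) \<in> limit_order \<omega>"
      using mem[OF ij] mem[OF ij(2,1)] by linarith
  qed
  ultimately show "limit_order \<omega> \<in> nat_orders"
    by (auto simp: nat_orders_def strict_linear_order_on_def limit_order_def)
qed

section \<open>Extension of stationary laws\<close>

theorem proposition6:
  fixes m :: nat and Pm :: "(nat \<Rightarrow> nat) pmf"
  assumes "1 \<le> m"
    and "stationary_perm_pmf m Pm"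
  shows "(\<exists>Q :: (nat \<Rightarrow> nat) pmf. stationary_perm_pmf (m + 1) Q \<and>
            (\<forall>\<sigma>\<in>perms m.
               measure_pmf.prob Q {\<pi> \<in> perms (m + 1). shows_pattern m \<pi> \<sigma>} = pmf Pm \<sigma>)) \<and>
         (\<exists>P :: (nat \<times> nat) set measure. stationary_random_order P \<and>
            (\<forall>\<sigma>\<in>perms m.
               measure P {r \<in> nat_orders. objects_show_pattern r 1 m \<sigma>} = pmf Pm \<sigma>))"
proof
  have ext: "\<exists>Q'. stationary_perm_pmf (n + 1) Q' \<and> map_pmf (std n) Q' = Q"
    if "1 \<le> n" "stationary_perm_pmf n Q" for n Q
    using stationary_extension[OF that] by blast
  obtain Q1 where Q1: "stationary_perm_pmf (m + 1) Q1" "map_pmf (std m) Q1 = Pm"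
    using ext[OF assms] by blast
  have "measure_pmf.prob Q1 {\<pi> \<in> perms (m + 1). shows_pattern m \<pi> \<sigma>} = pmf Pm \<sigma>"
    if "\<sigma> \<in> perms m" for \<sigma>
  proof -
    have "set_pmf Q1 \<subseteq> perms (m + 1)"
      using Q1(1) by (simp add: stationary_perm_pmf_def)
    from prob_shows_pattern[OF this that, of 1] show ?thesis
      by (simp add: Q1(2))
  qed
  with Q1(1) show "\<exists>Q. stationary_perm_pmf (m + 1) Q \<and>
    (\<forall>\<sigma>\<in>perms m. measure_pmf.prob Q {\<pi> \<in> perms (m + 1). shows_pattern m \<pi> \<sigma>} = pmf Pm \<sigma>)"
    by blast

  have "\<exists>Q. \<forall>n. (stationary_perm_pmf (m + n) (Q n) \<and> (n = 0 \<longrightarrow> Q n = Pm)) \<and>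
      map_pmf (std (m + n)) (Q (Suc n)) = Q n"
  proof (rule dependent_nat_choice)
    show "\<exists>Q. stationary_perm_pmf (m + 0) Q \<and> (0 = (0::nat) \<longrightarrow> Q = Pm)"
      using assms(2) by simp
    fix Q n assume "stationary_perm_pmf (m + n) Q \<and> (n = 0 \<longrightarrow> Q = Pm)"
    then show "\<exists>Q'. (stationary_perm_pmf (m + Suc n) Q' \<and> (Suc n = 0 \<longrightarrow> Q' = Pm)) \<and>
        map_pmf (std (m + n)) Q' = Q"
      using ext[of "m + n" Q] assms(1) by simp
  qed
  then obtain Q where st: "\<And>n. stationary_perm_pmf (m + n) (Q n)" and Q0: "Q 0 = Pm"
    and proj: "\<And>n. map_pmf (std (m + n)) (Q (Suc n)) = Q n"
    by blast
  have supp: "set_pmf (Q n) \<subseteq> perms (m + n)" for n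
    using st by (simp add: stationary_perm_pmf_def)
  obtain M :: "(nat \<Rightarrow> nat \<Rightarrow> nat) measure" where "prob_space M"
    and comp: "\<And>n. (\<lambda>\<omega>. \<omega> n) \<in> measurable M (count_space UNIV)"
    and law: "\<And>n. distr M (count_space UNIV) (\<lambda>\<omega>. \<omega> n) = measure_pmf (Q n)"
    and in_supp: "\<And>\<omega> n. \<omega> \<in> space M \<Longrightarrow> \<omega> n \<in> set_pmf (Q n)"
    and restr: "\<And>\<omega> n. \<omega> \<in> space M \<Longrightarrow> std (m + n) (\<omega> (Suc n)) = \<omega> n"
    by (rule pmf_inverse_limit[of "\<lambda>n. std (m + n)" Q, OF proj]) (rule that; assumption)
  interpret M: prob_space M by fact
  have order: "limit_order \<omega> \<in> nat_orders" if "\<omega> \<in> space M" for \<omega>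
    using in_supp[OF that] supp restr[OF that] by (intro limit_order(1)) auto
  have pattern: "objects_show_pattern (limit_order \<omega>) t k \<kappa> \<longleftrightarrow> shows_pattern k (window t (\<omega> n)) \<kappa>"
    if "\<omega> \<in> space M" "1 \<le> t" "t + k \<le> m + n + 1" for \<omega> t k \<kappa> n
    using that in_supp[OF that(1)] supp restr[OF that(1)]
    by (intro objects_show_pattern_iff order limit_order(2)) auto
  have pre: "limit_order -` {r \<in> nat_orders. objects_show_pattern r t k \<kappa>} \<inter> space M =
      (\<lambda>\<omega>. \<omega> n) -` {\<pi>. shows_pattern k (window t \<pi>) \<kappa>} \<inter> space M"
    if "1 \<le> t" "t + k \<le> m + n + 1" for t k \<kappa> n
    using pattern[OF _ that] order by auto
  have meas: "limit_order \<in> measurable M order_space"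
    unfolding order_space_def
  proof (rule measurable_measure_of)
    show "limit_order \<in> space M \<rightarrow> nat_orders"
      using order by blast
    fix A assume "A \<in> {{r \<in> nat_orders. objects_show_pattern r 1 k \<kappa>} |k \<kappa>. 2 \<le> k \<and> \<kappa> \<in> perms k}"
    then obtain k \<kappa> where A: "A = {r \<in> nat_orders. objects_show_pattern r 1 k \<kappa>}"
      by blast
    have "limit_order -` A \<inter> space M =
        (\<lambda>\<omega>. \<omega> k) -` {\<pi>. shows_pattern k (window 1 \<pi>) \<kappa>} \<inter> space M"
      unfolding A by (rule pre) simp_all
    also have "\<dots> \<in> sets M"
      by (rule measurable_sets[OF comp]) simp
    finally show "limit_order -` A \<inter> space M \<in> sets M" .
  qed blast
  \<comment> \<open>A window is read off from any stage long enough to contain it, whence its probability.\<close>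
  define P where "P = distr M order_space (limit_order)"
  have P: "measure P {r \<in> nat_orders. objects_show_pattern r t k \<kappa>} =
      pmf (map_pmf (\<lambda>\<pi>. std k (window t \<pi>)) (Q n)) \<kappa>"
    if t: "1 \<le> t" "t + k \<le> m + n + 1" and \<kappa>: "\<kappa> \<in> perms k" for t k \<kappa> n
  proof -
    have "measure P {r \<in> nat_orders. objects_show_pattern r t k \<kappa>} =
        measure M ((\<lambda>\<omega>. \<omega> n) -` {\<pi>. shows_pattern k (window t \<pi>) \<kappa>} \<inter> space M)"
      unfolding P_def measure_distr[OF meas pattern_event_in_sets[OF t(1)]] pre[OF t] ..
    also have "\<dots> = measure (measure_pmf (Q n)) {\<pi>. shows_pattern k (window t \<pi>) \<kappa>}"
      unfolding law[symmetric] by (rule measure_distr[symmetric, OF comp]) simp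
    also have "{\<pi>. shows_pattern k (window t \<pi>) \<kappa>} = (\<lambda>\<pi>. std k (window t \<pi>)) -` {\<kappa>}"
      using shows_pattern_iff_std[OF \<kappa>] by blast
    finally show ?thesis
      by (simp only: pmf_map)
  qed
  have "stationary_random_order P"
    unfolding stationary_random_order_def random_order_def
  proof (intro conjI allI impI)
    show "prob_space P"
      unfolding P_def by (rule M.prob_space_distr[OF meas])
    show "space P = space order_space" "sets P = sets order_space"
      by (simp_all add: P_def)
    fix k \<kappa> and s t :: nat
    assume k: "1 \<le> k \<and> \<kappa> \<in> perms k" and s: "1 \<le> s" and t: "1 \<le> t"
    define n where "n = s + t + k"
    have n: "k < m + n" "s + k \<le> m + n + 1" "t + k \<le> m + n + 1"
      "s \<in> {1..m + n + 1 - k}" "t \<in> {1..m + n + 1 - k}"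
      using s t by (auto simp: n_def)
    have "map_pmf (\<lambda>\<pi>. std k (window s \<pi>)) (Q n) = map_pmf (\<lambda>\<pi>. std k (window t \<pi>)) (Q n)"
      using st[of n] n unfolding stationary_iff_map_pmf by blast
    then show "measure P {r \<in> nat_orders. objects_show_pattern r s k \<kappa>} =
        measure P {r \<in> nat_orders. objects_show_pattern r t k \<kappa>}"
      using P[OF s n(2)] P[OF t n(3)] k by simp
  qed
  moreover have "measure P {r \<in> nat_orders. objects_show_pattern r 1 m \<sigma>} = pmf Pm \<sigma>"
    if \<sigma>: "\<sigma> \<in> perms m" for \<sigma>
  proof -
    have "map_pmf (\<lambda>\<pi>. std m (window 1 \<pi>)) Pm = Pm"
      using supp[of 0] by (intro map_pmf_idI) (auto simp: Q0 std_perm)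
    then show ?thesis
      using P[of 1 m 0 \<sigma>] \<sigma> by (simp add: Q0)
  qed
  ultimately show "\<exists>P. stationary_random_order P \<and>
    (\<forall>\<sigma>\<in>perms m. measure P {r \<in> nat_orders. objects_show_pattern r 1 m \<sigma>} = pmf Pm \<sigma>)"
    by blast
qed

end
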